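(* Let $\{A^{\pi}, \pi\in\Pi\}$ be a DP-inducible set. For any $\pi\in\Pi$, there exists $\pi^*\in F(\pi)$ (so $\pi^*$ is uniformly $\pi$-feasible, i.e. $J^{\pi^*}\le J^{\pi}$) such that $V^*(x,\pi)=V^{\pi^*}(x)$ for all $x\in X$.
   Context: $X$ is a finite state set and $A$ a finite action set; for each $x\in X$, $A(x)\subseteq A$ is the non-empty set of admissible actions at $x$. $P_{xy}^a$ is the probability of moving from $x$ to $y$ when action $a\in A(x)$ is taken at $x$ (so $P_{xy}^a\ge 0$, $\sum_{y\in X}P_{xy}^a=1$). $R$ and $C$ are real-valued functions on $\{(x,a): x\in X, a\in A(x)\}$ (reward and cost), and $\gamma,\beta\in(0,1)$ are discount factors. A policy is a map $\pi:X\to A$ with $\pi(x)\in A(x)$ for all $x$; $\Pi$ is the set of all policies. For $\pi\in\Pi$ and $x\in X$, $V^{\pi}(x)=E[\sum_{t=0}^{\infty}\gamma^tR(X_t,\pi(X_t))\mid X_0=x]$ and $J^{\pi}(x)=E[\sum_{t=0}^{\infty}\beta^tC(X_t,\pi(X_t))\mid X_0=x]$, where $(X_t)$ is the Markov chain with transition probabilities $P_{xy}^{\pi(x)}$. Inequalities between functions on $X$ are componentwise. $\Phi(\pi)=\{g\in\Pi: J^g\le J^{\pi}\}$; $g$ is uniformly $\pi$-feasible if $g\in\Phi(\pi)$. For each $\pi\in\Pi$ let $A^{\pi}$ assign to each $x\in X$ a set $A^{\pi}(x)$ with $\pi(x)\in A^{\pi}(x)\subseteq A(x)$, and let $F(\pi)=\{g\in\Pi: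 g(x)\in A^{\pi}(x)\ \forall x\in X\}$. The family $\{A^{\pi},\pi\in\Pi\}$ is called a DP-inducible set if $F(\pi)\subseteq\Phi(\pi)$ for all $\pi\in\Pi$. Given a DP-inducible set, define $V^*(x,\pi)=\max_{g\in F(\pi)}V^g(x)$ for $x\in X$, $\pi\in\Pi$. *)

theory Defs
  imports "HOL-Probability.Probability"
begin

section \<open>Path measure of a time-homogeneous Markov chain\<close>

text \<open>
  The canonical path measure on sequences of states, for a transition kernel \<open>K\<close> and a
  deterministic initial state \<open>x\<close>, is obtained from the Ionescu-Tulcea construction; the
  coordinate maps \<open>\<lambda>\<omega>. \<omega> t\<close> are the random variables of the chain.
\<close>

definition chain_step :: "('s \<Rightarrow> 's pmf) \<Rightarrow> 's \<Rightarrow> nat \<Rightarrow> (nat \<Rightarrow> 's) \<Rightarrow> 's measure" where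
  "chain_step K x n \<omega> = measure_pmf (case n of 0 \<Rightarrow> return_pmf x | Suc m \<Rightarrow> K (\<omega> m))"

lemma chain_step_measurable:
  "chain_step K x n \<in>
     measurable (PiM {0..<n} (\<lambda>_. count_space UNIV)) (subprob_algebra (count_space UNIV))"
proof (cases n)
  case 0
  then show ?thesis
    by (auto simp: chain_step_def[abs_def] measure_pmf_in_subprob_algebra)
next
  case (Suc m)
  have "(\<lambda>\<omega>. \<omega> m) \<in> measurable (PiM {0..<n} (\<lambda>_. count_space UNIV)) (count_space UNIV)"
    using Suc by (intro measurable_component_singleton) auto
  then have "(\<lambda>\<omega>. measure_pmf (K (\<omega> m))) \<in>
      measurable (PiM {0..<n} (\<lambda>_. count_space UNIV)) (subprob_algebra (count_space UNIV))"
    by (rule measurable_compose) (auto simp: measure_pmf_in_subprob_algebra)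
  then show ?thesis
    using Suc by (simp add: chain_step_def[abs_def])
qed

lemma prob_space_chain_step: "prob_space (chain_step K x n \<omega>)"
  unfolding chain_step_def by (rule measure_pmf.prob_space_axioms)

interpretation chain: Ionescu_Tulcea "chain_step K x" "\<lambda>_. count_space UNIV" for K x
  by (rule Ionescu_Tulcea.intro[OF chain_step_measurable prob_space_chain_step])

definition path_measure :: "('s \<Rightarrow> 's pmf) \<Rightarrow> 's \<Rightarrow> (nat \<Rightarrow> 's) measure" where
  "path_measure K x = chain.PF.lim K x"

lemma sets_path_measure: "sets (path_measure K x) = sets (PiM UNIV (\<lambda>_. count_space UNIV))"
  by (simp add: path_measure_def)

lemma prob_space_path_measure: "prob_space (path_measure K x)"
proof -
  have "emeasure (path_measure K x) (prod_emb UNIV (\<lambda>_. count_space UNIV) {}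
      (space (PiM {} (\<lambda>_. count_space UNIV)))) = emeasure (chain.CI K x {})
      (space (PiM {} (\<lambda>_. count_space UNIV)))"
    unfolding path_measure_def by (rule chain.lim) auto
  also have "\<dots> = 1"
    using prob_space.emeasure_space_1[OF chain.PF.prob_space_P[of "{}" K x]]
    by (simp add: chain.CI_def)
  also have "prod_emb UNIV (\<lambda>_. count_space UNIV) {} (space (PiM {} (\<lambda>_. count_space UNIV))) =
      space (path_measure K x)"
    by (auto simp: prod_emb_def space_PiM sets_eq_imp_space_eq[OF sets_path_measure])
  finally show ?thesis
    by (rule prob_spaceI)
qed

lemma emeasure_chain_C:
  "emeasure (chain.C K x 0 n (\<lambda>_. undefined)) {restrict s {0..<n}} =
     (\<Prod>i<n. emeasure (chain_step K x i s) {s i})"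
proof (induction n)
  case 0
  then show ?case
    by (simp add: space_PiM PiM_empty restrict_def)
next
  case (Suc n)
  let ?M = "\<lambda>n. PiM {0..<n} (\<lambda>_::nat. count_space (UNIV :: 'a set))"
  let ?C = "chain.C K x 0 n (\<lambda>_. undefined)"
  have sing: "{restrict s {0..<n}} \<in> sets (?M n)" for n
  proof -
    have "{restrict s {0..<n}} = PiE {0..<n} (\<lambda>i. {s i})"
      by (auto simp: PiE_iff extensional_def restrict_def fun_eq_iff)
    then show ?thesis
      by (simp only:) (rule sets_PiM_I_finite, auto)
  qed
  have ud: "(\<lambda>_. undefined) \<in> space (?M 0)"
    by (simp add: space_PiM)
  have sets_C: "sets ?C = sets (?M n)"
    using chain.sets_C[OF ud, of K x n] by simp
  have "emeasure (chain.C K x 0 (Suc n) (\<lambda>_. undefined)) {restrict s {0..<Suc n}} =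
      (\<integral>\<^sup>+\<omega>. emeasure (chain.eP K x n \<omega>) {restrict s {0..<Suc n}} \<partial>?C)"
    unfolding chain.C.simps add_0
  proof (rule emeasure_bind)
    show "space ?C \<noteq> {}"
      using chain.prob_space_C[OF ud, of K x n] prob_space.not_empty by blast
    show "chain.eP K x n \<in> measurable ?C (subprob_algebra (?M (Suc n)))"
      using chain.measurable_eP[of K x n] measurable_cong_sets[OF sets_C refl] by blast
  qed (rule sing)
  also have "\<dots> = (\<integral>\<^sup>+\<omega>. emeasure (chain_step K x n s) {s n} * indicator {restrict s {0..<n}} \<omega> \<partial>?C)"
  proof (rule nn_integral_cong)
    fix \<omega> assume "\<omega> \<in> space ?C"
    then have \<omega>: "\<omega> \<in> space (?M n)"
      by (simp add: sets_eq_imp_space_eq[OF sets_C])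
    then have ext: "\<omega> \<in> extensional {0..<n}"
      by (auto simp: space_PiM PiE_iff)
    have *: "fun_upd \<omega> n y = restrict s {0..<Suc n} \<longleftrightarrow> \<omega> = restrict s {0..<n} \<and> y = s n" for y
    proof
      assume h: "fun_upd \<omega> n y = restrict s {0..<Suc n}"
      have "\<omega> i = restrict s {0..<n} i" for i
        using fun_cong[OF h, of i] ext by (cases "i < n") (auto simp: extensional_def)
      moreover have "y = s n"
        using fun_cong[OF h, of n] by simp
      ultimately show "\<omega> = restrict s {0..<n} \<and> y = s n"
        by auto
    qed (auto simp: restrict_def fun_eq_iff)
    have "emeasure (chain.eP K x n \<omega>) {restrict s {0..<Suc n}} =
        emeasure (chain_step K x n \<omega>)
          ((\<lambda>y. fun_upd \<omega> n y) -` {restrict s {0..<Suc n}} \<inter> space (count_space UNIV))"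
      by (rule chain.emeasure_eP[OF \<omega> sing])
    also have "(\<lambda>y. fun_upd \<omega> n y) -` {restrict s {0..<Suc n}} \<inter> space (count_space UNIV) =
        (if \<omega> = restrict s {0..<n} then {s n} else {})"
      using * by auto
    also have "emeasure (chain_step K x n \<omega>) \<dots> =
        emeasure (chain_step K x n s) {s n} * indicator {restrict s {0..<n}} \<omega>"
      by (auto simp: chain_step_def split: nat.split)
    finally show "emeasure (chain.eP K x n \<omega>) {restrict s {0..<Suc n}} =
        emeasure (chain_step K x n s) {s n} * indicator {restrict s {0..<n}} \<omega>" .
  qed
  also have "\<dots> = emeasure (chain_step K x n s) {s n} * emeasure ?C {restrict s {0..<n}}"
    by (rule nn_integral_cmult_indicator) (simp add: sets_C sing)
  finally show ?case
    unfolding Suc.IH prod.lessThan_Suc by (simp only: mult.commute)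
qed

text \<open>
  The finite-dimensional distributions are those of a Markov chain started in \<open>x\<close> with
  transition probabilities \<open>pmf (K y) z\<close>.
\<close>

lemma path_measure_cylinder:
  "measure (path_measure K x) {\<omega>. \<forall>i\<le>n. \<omega> i = s i} =
     (if s 0 = x then \<Prod>i<n. pmf (K (s i)) (s (Suc i)) else 0)"
proof -
  let ?M = "\<lambda>_::nat. count_space (UNIV :: 'a set)"
  let ?J = "{0..<Suc n}"
  have sing: "{restrict s ?J} \<in> sets (PiM ?J ?M)"
  proof -
    have "{restrict s ?J} = PiE ?J (\<lambda>i. {s i})"
      by (auto simp: PiE_iff extensional_def restrict_def fun_eq_iff)
    then show ?thesis
      by (simp only:) (rule sets_PiM_I_finite, auto)
  qed
  have "{\<omega>. \<forall>i\<le>n. \<omega> i = s i} = prod_emb UNIV ?M ?J {restrict s ?J}"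
    by (auto simp: prod_emb_def space_PiM restrict_def fun_eq_iff)
       (metis less_Suc_eq_le)
  then have "emeasure (path_measure K x) {\<omega>. \<forall>i\<le>n. \<omega> i = s i} =
      emeasure (chain.CI K x ?J) {restrict s ?J}"
    using chain.lim[OF _ sing, of K x] by (simp add: path_measure_def)
  also have "\<dots> = emeasure (chain.C K x 0 (Suc n) (\<lambda>_. undefined)) {restrict s ?J}"
    using chain.emeasure_CI[of ?J "Suc n" "{restrict s ?J}" K x] sing
    by (simp add: prod_emb_id sets.sets_into_space del: chain.C.simps)
  also have "\<dots> = (\<Prod>i<Suc n. emeasure (chain_step K x i s) {s i})"
    by (rule emeasure_chain_C)
  also have "\<dots> = emeasure (chain_step K x 0 s) {s 0} *
      (\<Prod>i<n. emeasure (chain_step K x (Suc i) s) {s (Suc i)})"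
    by (rule prod.lessThan_Suc_shift)
  also have "\<dots> = ennreal (if s 0 = x then \<Prod>i<n. pmf (K (s i)) (s (Suc i)) else 0)"
    by (auto simp: chain_step_def emeasure_pmf_single prod_ennreal)
  finally show ?thesis
    by (simp add: measure_def prod_nonneg)
qed

section \<open>Discounted Markov decision processes\<close>

text \<open>
  States and actions range over finite types; \<open>A x\<close> is the set of actions admissible in \<open>x\<close>
  and \<open>pmf (P x a) y\<close> is the probability of moving from \<open>x\<close> to \<open>y\<close> under \<open>a\<close>. The values of
  \<open>P x a\<close>, \<open>R x a\<close> and \<open>C x a\<close> for inadmissible \<open>a\<close> are never used.
\<close>

definition policies :: "('x \<Rightarrow> 'a set) \<Rightarrow> ('x \<Rightarrow> 'a) set" where
  "policies A = {\<pi>. \<forall>x. \<pi> x \<in> A x}"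

definition discounted_value ::
    "('x \<Rightarrow> 'a \<Rightarrow> 'x pmf) \<Rightarrow> ('x \<Rightarrow> 'a \<Rightarrow> real) \<Rightarrow> real \<Rightarrow> ('x \<Rightarrow> 'a) \<Rightarrow> 'x \<Rightarrow> real" where
  "discounted_value P f \<delta> \<pi> x =
     (\<integral>\<omega>. (\<Sum>t. \<delta> ^ t * f (\<omega> t) (\<pi> (\<omega> t))) \<partial>path_measure (\<lambda>y. P y (\<pi> y)) x)"

definition uniformly_feasible ::
    "('x \<Rightarrow> 'a \<Rightarrow> 'x pmf) \<Rightarrow> ('x \<Rightarrow> 'a \<Rightarrow> real) \<Rightarrow> real \<Rightarrow> ('x \<Rightarrow> 'a set) \<Rightarrow> ('x \<Rightarrow> 'a) \<Rightarrow>
       ('x \<Rightarrow> 'a) set" where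
  "uniformly_feasible P C \<beta> A \<pi> =
     {g \<in> policies A. \<forall>x. discounted_value P C \<beta> g x \<le> discounted_value P C \<beta> \<pi> x}"

definition induced_policies ::
    "('x \<Rightarrow> 'a set) \<Rightarrow> (('x \<Rightarrow> 'a) \<Rightarrow> 'x \<Rightarrow> 'a set) \<Rightarrow> ('x \<Rightarrow> 'a) \<Rightarrow> ('x \<Rightarrow> 'a) set" where
  "induced_policies A \<A> \<pi> = {g \<in> policies A. \<forall>x. g x \<in> \<A> \<pi> x}"

definition DP_inducible ::
    "('x \<Rightarrow> 'a \<Rightarrow> 'x pmf) \<Rightarrow> ('x \<Rightarrow> 'a \<Rightarrow> real) \<Rightarrow> real \<Rightarrow> ('x \<Rightarrow> 'a set) \<Rightarrow>
       (('x \<Rightarrow> 'a) \<Rightarrow> 'x \<Rightarrow> 'a set) \<Rightarrow> bool" where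
  "DP_inducible P C \<beta> A \<A> \<longleftrightarrow>
     (\<forall>\<pi> \<in> policies A. (\<forall>x. \<pi> x \<in> \<A> \<pi> x \<and> \<A> \<pi> x \<subseteq> A x) \<and>
        induced_policies A \<A> \<pi> \<subseteq> uniformly_feasible P C \<beta> A \<pi>)"

definition induced_optimal_value ::
    "('x \<Rightarrow> 'a \<Rightarrow> 'x pmf) \<Rightarrow> ('x \<Rightarrow> 'a \<Rightarrow> real) \<Rightarrow> real \<Rightarrow> ('x \<Rightarrow> 'a set) \<Rightarrow>
       (('x \<Rightarrow> 'a) \<Rightarrow> 'x \<Rightarrow> 'a set) \<Rightarrow> 'x \<Rightarrow> ('x \<Rightarrow> 'a) \<Rightarrow> real" where
  "induced_optimal_value P R \<gamma> A \<A> x \<pi> =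
     Max ((\<lambda>g. discounted_value P R \<gamma> g x) ` induced_policies A \<A> \<pi>)"

end

theory Submission
  imports Defs
begin

text \<open>
  By the Markov property a value function satisfies the one-step equation
  \<open>V\<^sup>g x = f x (g x) + \<delta> * (\<Sum>y. P x (g x) y * V\<^sup>g y)\<close>. Pasting together two policies
  \<open>g\<close>, \<open>h\<close> by choosing in each state the action of the one with the larger value gives a policy
  whose value dominates both. Since \<open>F(\<pi>)\<close> is a product set it is closed under
  pasting, so a policy in it maximising \<open>\<Sum>x. V\<^sup>g x\<close> is optimal in every state at once.
\<close>

section \<open>Marginals of the path measure\<close>

text \<open>The Markov operator of the chain, acting on functions: the mean of \<open>h\<close> one
  step after \<open>y\<close>. Its iterate \<open>kernel_op K ^^ t\<close> is the transition
  operator for \<open>t\<close> steps.\<close>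

definition kernel_op :: "('s::finite \<Rightarrow> 's pmf) \<Rightarrow> ('s \<Rightarrow> real) \<Rightarrow> 's \<Rightarrow> real" where
  "kernel_op K h y = (\<Sum>z\<in>UNIV. pmf (K y) z * h z)"

lemma kernel_op_const: "kernel_op K (\<lambda>_. c) y = c"
  by (simp add: kernel_op_def sum_distrib_right[symmetric] sum_pmf_eq_1)

lemma kernel_op_mono: "(\<And>z. h z \<le> k z) \<Longrightarrow> kernel_op K h y \<le> kernel_op K k y"
  unfolding kernel_op_def by (intro sum_mono mult_left_mono) auto

lemma kernel_op_diff: "kernel_op K (\<lambda>z. h z - k z) y = kernel_op K h y - kernel_op K k y"
  by (simp add: kernel_op_def algebra_simps sum_subtractf)

lemma abs_kernel_op_le:
  assumes "\<And>z. \<bar>h z\<bar> \<le> B"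
  shows "\<bar>kernel_op K h y\<bar> \<le> B"
proof -
  have "kernel_op K h y \<le> kernel_op K (\<lambda>_. B) y"
    using assms by (intro kernel_op_mono) (metis abs_le_D1)
  moreover have "kernel_op K (\<lambda>_. - B) y \<le> kernel_op K h y"
    using assms by (intro kernel_op_mono) (metis abs_le_D2 minus_le_iff)
  ultimately show ?thesis
    by (simp add: kernel_op_const abs_le_iff)
qed

lemma abs_kernel_op_iterate_le:
  assumes "\<And>z. \<bar>h z\<bar> \<le> B"
  shows "\<bar>(kernel_op K ^^ t) h y\<bar> \<le> B"
  using assms by (induction t arbitrary: y) (auto intro: abs_kernel_op_le)

text \<open>A crude bound uniform in the state. It is the constant that dominates rewards in the
  integrability and summability arguments.\<close>

lemma abs_le_sum_abs: "\<bar>h z\<bar> \<le> (\<Sum>y\<in>UNIV. \<bar>h y :: real\<bar>)" for z :: "'s::finite"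
  by (rule member_le_sum[where f = "\<lambda>y. \<bar>h y\<bar>"]) auto

lemma space_path_measure: "space (path_measure K x) = UNIV"
  using sets_eq_imp_space_eq[OF sets_path_measure, of K x] by (simp add: space_PiM)

lemma measurable_path_coordinate:
  "(\<lambda>\<omega>. \<omega> n) \<in> measurable (path_measure K x) (count_space UNIV)"
  unfolding measurable_cong_sets[OF sets_path_measure refl]
  by (rule measurable_component_singleton) simp

lemma cylinder_in_sets: "{\<omega>. \<forall>i\<le>n. \<omega> i = s i} \<in> sets (path_measure K x)"
proof -
  have "{\<omega> \<in> space (path_measure K x). \<forall>i\<in>{..n}. \<omega> i = s i} \<in> sets (path_measure K x)"
  proof (rule sets.sets_Collect_finite_All)
    fix i
    have "(\<lambda>\<omega>. \<omega> i) -` {s i} \<inter> space (path_measure K x) \<in> sets (path_measure K x)"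
      by (rule measurable_sets[OF measurable_path_coordinate]) simp
    also have "(\<lambda>\<omega>. \<omega> i) -` {s i} \<inter> space (path_measure K x) =
        {\<omega> \<in> space (path_measure K x). \<omega> i = s i}"
      by blast
    finally show "{\<omega> \<in> space (path_measure K x). \<omega> i = s i} \<in> sets (path_measure K x)" .
  qed simp
  also have "{\<omega> \<in> space (path_measure K x). \<forall>i\<in>{..n}. \<omega> i = s i} = {\<omega>. \<forall>i\<le>n. \<omega> i = s i}"
    unfolding space_path_measure by blast
  finally show ?thesis .
qed

lemma integrable_path_coordinate:
  fixes h :: "'s::finite \<Rightarrow> real"
  shows "integrable (path_measure K x) (\<lambda>\<omega>. h (\<omega> n))"
proof -
  interpret prob_space "path_measure K x"
    by (rule prob_space_path_measure)
  show ?thesis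
  proof (rule integrable_const_bound)
    show "AE \<omega> in path_measure K x. norm (h (\<omega> n)) \<le> (\<Sum>y\<in>UNIV. \<bar>h y\<bar>)"
      by (intro AE_I2) (simp add: abs_le_sum_abs)
    show "(\<lambda>\<omega>. h (\<omega> n)) \<in> borel_measurable (path_measure K x)"
      by (rule measurable_compose[OF measurable_path_coordinate]) simp
  qed
qed

text \<open>The hypothesis says that \<open>H\<close> depends on the coordinates up to
  \<open>n\<close> only. The cylinders of the words in \<open>PiE {..n}\<close> partition the path
  space, so exactly one summand survives, that of \<open>restrict \<omega> {..n}\<close>.\<close>

lemma sum_indicator_cylinder:
  fixes \<omega> :: "nat \<Rightarrow> 's::finite" and H :: "(nat \<Rightarrow> 's) \<Rightarrow> real"
  assumes "\<And>s. H s = H (restrict s {..n})"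
  shows "H \<omega> = (\<Sum>s\<in>PiE {..n} (\<lambda>_. UNIV). indicator {\<omega>. \<forall>i\<le>n. \<omega> i = s i} \<omega> * H s)"
proof -
  have "(\<Sum>s\<in>PiE {..n} (\<lambda>_. UNIV). indicator {\<omega>. \<forall>i\<le>n. \<omega> i = s i} \<omega> * H s)
      = (\<Sum>s\<in>{restrict \<omega> {..n}}. indicator {\<omega>. \<forall>i\<le>n. \<omega> i = s i} \<omega> * H s)"
  proof (rule sum.mono_neutral_right)
    show "\<forall>s\<in>PiE {..n} (\<lambda>_. UNIV) - {restrict \<omega> {..n}}.
        indicator {\<omega>. \<forall>i\<le>n. \<omega> i = s i} \<omega> * H s = 0"
    proof
      fix s assume s: "s \<in> PiE {..n} (\<lambda>_. UNIV) - {restrict \<omega> {..n}}"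
      have "\<not> (\<forall>i\<le>n. \<omega> i = s i)"
      proof
        assume "\<forall>i\<le>n. \<omega> i = s i"
        \<comment> \<open>Elements of \<open>PiE\<close> are \<open>undefined\<close> beyond
          \<open>n\<close>, so agreement up to \<open>n\<close> determines \<open>s\<close>
          completely.\<close>
        then have "s = restrict \<omega> {..n}"
          using s by (auto simp: PiE_iff extensional_def restrict_def fun_eq_iff)
        with s show False by simp
      qed
      then show "indicator {\<omega>. \<forall>i\<le>n. \<omega> i = s i} \<omega> * H s = 0"
        by (simp add: indicator_def)
    qed
  qed (auto intro: finite_PiE)
  also have "\<dots> = H \<omega>"
    by (simp add: assms[of \<omega>, symmetric])
  finally show ?thesis by (rule sym)
qed

text \<open>Turns expectations into finite sums over words, where the explicit cylinder
  probabilities can be used.\<close>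

lemma integral_path_cylinders:
  fixes H :: "(nat \<Rightarrow> 's::finite) \<Rightarrow> real"
  assumes "\<And>s. H s = H (restrict s {..n})"
  shows "(\<integral>\<omega>. H \<omega> \<partial>path_measure K x) =
    (\<Sum>s\<in>PiE {..n} (\<lambda>_. UNIV). measure (path_measure K x) {\<omega>. \<forall>i\<le>n. \<omega> i = s i} * H s)"
proof -
  interpret prob_space "path_measure K x"
    by (rule prob_space_path_measure)
  have "(\<integral>\<omega>. H \<omega> \<partial>path_measure K x) = (\<integral>\<omega>. (\<Sum>s\<in>PiE {..n} (\<lambda>_. UNIV).
      indicator {\<omega>. \<forall>i\<le>n. \<omega> i = s i} \<omega> * H s) \<partial>path_measure K x)"
    by (rule Bochner_Integration.integral_cong[OF refl sum_indicator_cylinder]) (rule assms)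
  also have "\<dots> = (\<Sum>s\<in>PiE {..n} (\<lambda>_. UNIV).
      \<integral>\<omega>. indicator {\<omega>. \<forall>i\<le>n. \<omega> i = s i} \<omega> * H s \<partial>path_measure K x)"
    by (intro Bochner_Integration.integral_sum integrable_mult_left integrable_real_indicator
        cylinder_in_sets) (simp add: emeasure_eq_measure)
  also have "\<dots> = (\<Sum>s\<in>PiE {..n} (\<lambda>_. UNIV).
      measure (path_measure K x) {\<omega>. \<forall>i\<le>n. \<omega> i = s i} * H s)"
    by (simp add: space_path_measure)
  finally show ?thesis .
qed

text \<open>The product formula gains one factor, and the update at \<open>Suc n\<close> leaves the
  earlier factors and the initial state untouched.\<close>

lemma measure_cylinder_Suc:
  "measure (path_measure K x) {\<omega>. \<forall>i\<le>Suc n. \<omega> i = (s(Suc n := z)) i} =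
   measure (path_measure K x) {\<omega>. \<forall>i\<le>n. \<omega> i = s i} * pmf (K (s n)) z"
  unfolding path_measure_cylinder by simp

lemma sum_PiE_atMost_Suc:
  fixes G :: "(nat \<Rightarrow> 's::finite) \<Rightarrow> real"
  shows "(\<Sum>s\<in>PiE {..Suc n} (\<lambda>_. UNIV). G s) =
    (\<Sum>s\<in>PiE {..n} (\<lambda>_. UNIV). \<Sum>z\<in>UNIV. G (s(Suc n := z)))"
proof -
  have inj: "inj_on (\<lambda>(z, s). s(Suc n := z)) (UNIV \<times> PiE {..n} (\<lambda>_. UNIV :: 's set))"
    by (rule inj_combinator) simp
  have "(\<Sum>s\<in>PiE {..Suc n} (\<lambda>_. UNIV). G s) =
      (\<Sum>(z, s)\<in>UNIV \<times> PiE {..n} (\<lambda>_. UNIV). G (s(Suc n := z)))"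
    unfolding atMost_Suc PiE_insert_eq by (subst sum.reindex[OF inj]) (simp add: case_prod_unfold)
  also have "\<dots> = (\<Sum>z\<in>UNIV. \<Sum>s\<in>PiE {..n} (\<lambda>_. UNIV). G (s(Suc n := z)))"
    by (rule sum.cartesian_product[symmetric])
  also have "\<dots> = (\<Sum>s\<in>PiE {..n} (\<lambda>_. UNIV). \<Sum>z\<in>UNIV. G (s(Suc n := z)))"
    by (rule sum.swap)
  finally show ?thesis .
qed

text \<open>The Markov property for expectations: summing out the last letter \<open>z\<close> of a
  word turns the last factor \<open>pmf (K (s n)) z\<close>, weighted by \<open>h z\<close>, into
  \<open>kernel_op K h (s n)\<close>.\<close>

lemma integral_path_Suc:
  fixes h :: "'s::finite \<Rightarrow> real"
  shows "(\<integral>\<omega>. h (\<omega> (Suc n)) \<partial>path_measure K x) = (\<integral>\<omega>. kernel_op K h (\<omega> n) \<partial>path_measure K x)"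
proof -
  let ?m = "measure (path_measure K x)"
  have "(\<integral>\<omega>. h (\<omega> (Suc n)) \<partial>path_measure K x) =
      (\<Sum>s\<in>PiE {..Suc n} (\<lambda>_. UNIV). ?m {\<omega>. \<forall>i\<le>Suc n. \<omega> i = s i} * h (s (Suc n)))"
    by (rule integral_path_cylinders) simp
  also have "\<dots> = (\<Sum>s\<in>PiE {..n} (\<lambda>_. UNIV). \<Sum>z\<in>UNIV.
      ?m {\<omega>. \<forall>i\<le>Suc n. \<omega> i = (s(Suc n := z)) i} * h ((s(Suc n := z)) (Suc n)))"
    by (rule sum_PiE_atMost_Suc)
  also have "\<dots> = (\<Sum>s\<in>PiE {..n} (\<lambda>_. UNIV).
      ?m {\<omega>. \<forall>i\<le>n. \<omega> i = s i} * kernel_op K h (s n))"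
    unfolding measure_cylinder_Suc kernel_op_def sum_distrib_left
    by (simp only: fun_upd_same mult.assoc)
  also have "\<dots> = (\<integral>\<omega>. kernel_op K h (\<omega> n) \<partial>path_measure K x)"
    by (rule integral_path_cylinders[symmetric]) simp
  finally show ?thesis .
qed

lemma integral_path_0:
  fixes h :: "'s::finite \<Rightarrow> real"
  shows "(\<integral>\<omega>. h (\<omega> 0) \<partial>path_measure K x) = h x"
proof -
  interpret prob_space "path_measure K x"
    by (rule prob_space_path_measure)
  \<comment> \<open>The cylinder of length one has an empty product of transition
    probabilities.\<close>
  have "prob {\<omega>. \<forall>i\<le>0. \<omega> i = x} = 1"
    using path_measure_cylinder[of K x 0 "\<lambda>_. x"] by simp
  then have "AE \<omega> in path_measure K x. \<omega> \<in> {\<omega>. \<forall>i\<le>0. \<omega> i = x}"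
    by (rule AE_prob_1)
  then have "(\<integral>\<omega>. h (\<omega> 0) \<partial>path_measure K x) = (\<integral>\<omega>. h x \<partial>path_measure K x)"
    by (intro integral_cong_AE borel_measurable_integrable[OF integrable_path_coordinate]) auto
  then show ?thesis
    by (simp add: prob_space)
qed

text \<open>Each step back in time replaces \<open>h\<close> by \<open>kernel_op K h\<close>, so the
  induction leaves \<open>h\<close> arbitrary and peels off the innermost operator with
  \<open>funpow_Suc_right\<close>.\<close>

lemma integral_path_coordinate:
  fixes h :: "'s::finite \<Rightarrow> real"
  shows "(\<integral>\<omega>. h (\<omega> n) \<partial>path_measure K x) = (kernel_op K ^^ n) h x"
proof (induction n arbitrary: h)
  case 0
  then show ?case by (simp add: integral_path_0)
next
  case (Suc n)
  then show ?case by (simp add: integral_path_Suc funpow_Suc_right del: funpow.simps)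
qed

section \<open>The one-step equation\<close>

abbreviation policy_kernel :: "('x \<Rightarrow> 'a \<Rightarrow> 'x pmf) \<Rightarrow> ('x \<Rightarrow> 'a) \<Rightarrow> 'x \<Rightarrow> 'x pmf" where
  "policy_kernel P g \<equiv> \<lambda>y. P y (g y)"

lemma summable_discounted_iterates:
  assumes "0 < \<delta>" "\<delta> < 1"
  shows "summable (\<lambda>t. \<delta> ^ t * (kernel_op K ^^ t) h x)"
proof (rule summable_comparison_test)
  show "\<exists>N. \<forall>t\<ge>N. norm (\<delta> ^ t * (kernel_op K ^^ t) h x) \<le> \<delta> ^ t * (\<Sum>y\<in>UNIV. \<bar>h y\<bar>)"
    using assms by (simp add: abs_mult abs_kernel_op_iterate_le[OF abs_le_sum_abs[where h = h]])
  show "summable (\<lambda>t. \<delta> ^ t * (\<Sum>y\<in>UNIV. \<bar>h y\<bar>))"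
    using assms by (intro summable_mult2 summable_geometric) auto
qed

text \<open>Rewards are bounded on a finite state space, so a geometric series dominates the
  discounted rewards on every path and in the mean. This permits exchanging sum and
  expectation.\<close>

lemma discounted_value_eq_suminf:
  fixes P :: "'x::finite \<Rightarrow> 'a \<Rightarrow> 'x pmf"
  assumes "0 < \<delta>" "\<delta> < 1"
  shows "discounted_value P f \<delta> g x =
    (\<Sum>t. \<delta> ^ t * (kernel_op (policy_kernel P g) ^^ t) (\<lambda>y. f y (g y)) x)"
proof -
  let ?M = "path_measure (policy_kernel P g) x"
  let ?r = "\<lambda>y. f y (g y)"
  interpret prob_space ?M
    by (rule prob_space_path_measure)
  have geom: "summable (\<lambda>t. \<delta> ^ t * (\<Sum>y\<in>UNIV. \<bar>?r y\<bar>))"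
    using assms by (intro summable_mult2 summable_geometric) auto
  have bound: "norm (\<delta> ^ t * ?r y) \<le> \<delta> ^ t * (\<Sum>y\<in>UNIV. \<bar>?r y\<bar>)" for t y
    using assms abs_le_sum_abs[where h = ?r] by (simp add: abs_mult)
  have "discounted_value P f \<delta> g x = (\<Sum>t. \<integral>\<omega>. \<delta> ^ t * ?r (\<omega> t) \<partial>?M)"
    unfolding discounted_value_def
  proof (rule integral_suminf)
    show int: "integrable ?M (\<lambda>\<omega>. \<delta> ^ t * ?r (\<omega> t))" for t
      by (rule integrable_path_coordinate)
    show "AE \<omega> in ?M. summable (\<lambda>t. norm (\<delta> ^ t * ?r (\<omega> t)))"
      using bound by (intro AE_I2 summable_comparison_test[OF _ geom]) auto
    have "(\<integral>\<omega>. norm (\<delta> ^ t * ?r (\<omega> t)) \<partial>?M) \<le> \<delta> ^ t * (\<Sum>y\<in>UNIV. \<bar>?r y\<bar>)" for t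
      using bound int by (intro integral_le_const integrable_norm AE_I2)
    then show "summable (\<lambda>t. \<integral>\<omega>. norm (\<delta> ^ t * ?r (\<omega> t)) \<partial>?M)"
      by (intro summable_comparison_test[OF _ geom]) auto
  qed
  then show ?thesis
    using integral_path_coordinate[where h = ?r]
    by simp
qed

lemma discounted_value_one_step:
  fixes P :: "'x::finite \<Rightarrow> 'a \<Rightarrow> 'x pmf"
  assumes "0 < \<delta>" "\<delta> < 1"
  shows "discounted_value P f \<delta> g x =
    f x (g x) + \<delta> * kernel_op (policy_kernel P g) (discounted_value P f \<delta> g) x"
proof -
  let ?T = "kernel_op (policy_kernel P g)"
  let ?r = "\<lambda>y. f y (g y)"
  let ?u = "\<lambda>t y. \<delta> ^ t * (?T ^^ t) ?r y"
  note summable = summable_discounted_iterates[OF assms, of "policy_kernel P g" ?r]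
  have V: "discounted_value P f \<delta> g = (\<lambda>y. \<Sum>t. ?u t y)"
    by (simp add: discounted_value_eq_suminf[OF assms] fun_eq_iff)
  \<comment> \<open>In the tail of the series the outermost operator, the first transition out of
    \<open>x\<close>, is split off with one factor \<open>\<delta>\<close>. Being a finite sum, it
    then commutes with the series.\<close>
  have "(\<Sum>t. ?u (Suc t) x) = (\<Sum>t. \<delta> * (\<Sum>z\<in>UNIV. pmf (P x (g x)) z * ?u t z))"
    by (simp add: kernel_op_def sum_distrib_left mult_ac)
  also have "\<dots> = \<delta> * (\<Sum>t. \<Sum>z\<in>UNIV. pmf (P x (g x)) z * ?u t z)"
    by (intro suminf_mult summable_sum summable_mult summable)
  also have "\<dots> = \<delta> * (\<Sum>z\<in>UNIV. \<Sum>t. pmf (P x (g x)) z * ?u t z)"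
    by (subst suminf_sum) (intro summable_mult summable, rule refl)
  also have "\<dots> = \<delta> * ?T (discounted_value P f \<delta> g) x"
    by (simp add: V kernel_op_def suminf_mult[OF summable])
  finally show ?thesis
    using suminf_split_head[OF summable, of x] unfolding V by simp
qed

section \<open>Pasting policies\<close>

text \<open>A maximum principle. Subtracting the one-step equation from \<open>sub\<close> at a
  state where \<open>U\<close> minus the value attains its maximum \<open>m\<close> gives
  \<open>m \<le> \<delta> * m\<close>, hence \<open>m \<le> 0\<close>.\<close>

lemma le_discounted_value_of_subsolution:
  fixes P :: "'x::finite \<Rightarrow> 'a \<Rightarrow> 'x pmf"
  assumes "0 < \<delta>" "\<delta> < 1"
    and sub: "\<And>y. U y \<le> f y (g y) + \<delta> * kernel_op (policy_kernel P g) U y"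
  shows "U x \<le> discounted_value P f \<delta> g x"
proof -
  let ?D = "\<lambda>y. U y - discounted_value P f \<delta> g y"
  define m where "m = Max (range ?D)"
  have le_m: "?D y \<le> m" for y
    unfolding m_def by (rule Max_ge) auto
  have "m \<in> range ?D"
    unfolding m_def by (rule Max_in) auto
  then obtain y where y: "m = ?D y" by auto
  have "m \<le> \<delta> * kernel_op (policy_kernel P g) ?D y"
    using sub[of y] discounted_value_one_step[OF assms(1,2), of P f g y]
    by (simp add: y kernel_op_diff algebra_simps)
  also have "\<dots> \<le> \<delta> * kernel_op (policy_kernel P g) (\<lambda>_. m) y"
    using assms(1) by (intro mult_left_mono kernel_op_mono le_m) auto
  finally have "m * (1 - \<delta>) \<le> 0"
    by (simp add: kernel_op_const algebra_simps)
  then have "m \<le> 0"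
    using assms(2) by (simp add: mult_le_0_iff)
  then show ?thesis
    using le_m[of x] by simp
qed

text \<open>The pointwise maximum of the two values is a subsolution for the pasted policy, so the
  maximum principle applies.\<close>

lemma discounted_value_paste_ge:
  fixes P :: "'x::finite \<Rightarrow> 'a \<Rightarrow> 'x pmf" and f :: "'x \<Rightarrow> 'a \<Rightarrow> real" and g h :: "'x \<Rightarrow> 'a"
  assumes "0 < \<delta>" "\<delta> < 1"
  defines "V \<equiv> discounted_value P f \<delta>"
  shows "max (V g x) (V h x) \<le> V (\<lambda>y. if V g y < V h y then h y else g y) x"
proof -
  let ?p = "\<lambda>y. if V g y < V h y then h y else g y"
  let ?U = "\<lambda>y. max (V g y) (V h y)"
  have "?U y \<le> f y (?p y) + \<delta> * kernel_op (policy_kernel P ?p) ?U y" for y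
  proof -
    \<comment> \<open>With \<open>y\<close> fixed, \<open>?k\<close> is a whole policy, the better
      of the two at \<open>y\<close>. Unlike \<open>?p\<close> it is \<open>g\<close> or
      \<open>h\<close> itself, so its value is one of the two under the maximum.\<close>
    let ?k = "if V g y < V h y then h else g"
    have "?U y = V ?k y"
      by auto
    also have "\<dots> = f y (?k y) + \<delta> * kernel_op (policy_kernel P ?k) (V ?k) y"
      unfolding V_def by (rule discounted_value_one_step[OF assms(1,2)])
    also have "\<dots> \<le> f y (?k y) + \<delta> * kernel_op (policy_kernel P ?k) ?U y"
      using assms(1) by (intro add_left_mono mult_left_mono kernel_op_mono) auto
    \<comment> \<open>At \<open>y\<close> the operator sees only the action taken in
      \<open>y\<close>, where \<open>?p\<close> and \<open>?k\<close> agree.\<close>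
    also have "\<dots> = f y (?p y) + \<delta> * kernel_op (policy_kernel P ?p) ?U y"
      by (simp add: kernel_op_def)
    finally show ?thesis .
  qed
  then show ?thesis
    unfolding V_def by (rule le_discounted_value_of_subsolution[OF assms(1,2)])
qed

text \<open>Summing over states gives a scalar objective with a maximiser \<open>g\<close>. If some
  \<open>h\<close> beat \<open>g\<close> in one state, pasting would lose nowhere and gain there,
  giving a larger sum.\<close>

lemma ex_uniformly_optimal_policy:
  fixes P :: "'x::finite \<Rightarrow> 'a \<Rightarrow> 'x pmf" and F :: "('x \<Rightarrow> 'a) set"
  assumes "0 < \<delta>" "\<delta> < 1" "finite F" "F \<noteq> {}"
    and paste: "\<And>g h B. g \<in> F \<Longrightarrow> h \<in> F \<Longrightarrow> (\<lambda>y. if B y then h y else g y) \<in> F"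
  shows "\<exists>g\<in>F. \<forall>h\<in>F. \<forall>x. discounted_value P f \<delta> h x \<le> discounted_value P f \<delta> g x"
proof -
  let ?V = "discounted_value P f \<delta>"
  let ?S = "\<lambda>g. \<Sum>x\<in>UNIV. ?V g x"
  have "Max (?S ` F) \<in> ?S ` F"
    using assms by (intro Max_in) auto
  then obtain g where g: "g \<in> F" "?S g = Max (?S ` F)" by auto
  have "?V h x \<le> ?V g x" if h: "h \<in> F" for h x
  proof (rule ccontr)
    assume less: "\<not> ?V h x \<le> ?V g x"
    let ?p = "\<lambda>y. if ?V g y < ?V h y then h y else g y"
    have ge: "max (?V g y) (?V h y) \<le> ?V ?p y" for y
      by (rule discounted_value_paste_ge[OF assms(1,2)])
    have "?S g < ?S ?p"
    proof (rule sum_strict_mono_ex1)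
      show "\<forall>y\<in>UNIV. ?V g y \<le> ?V ?p y"
        using ge by simp
      show "\<exists>y\<in>UNIV. ?V g y < ?V ?p y"
        using ge[of x] less by (intro bexI[of _ x]) auto
    qed simp
    moreover have "?S ?p \<le> ?S g"
      unfolding g(2) using assms(3) paste[OF g(1) h] by (intro Max_ge) auto
    ultimately show False by simp
  qed
  with g show ?thesis by blast
qed

theorem mainTheorem1:
  fixes A :: "'x::finite \<Rightarrow> 'a::finite set"
    and P :: "'x \<Rightarrow> 'a \<Rightarrow> 'x pmf"
    and R C :: "'x \<Rightarrow> 'a \<Rightarrow> real"
    and \<gamma> \<beta> :: real
    and \<A> :: "('x \<Rightarrow> 'a) \<Rightarrow> 'x \<Rightarrow> 'a set"
    and \<pi> :: "'x \<Rightarrow> 'a"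
  assumes "\<And>x. A x \<noteq> {}"
    and "0 < \<gamma>" "\<gamma> < 1"
    and "0 < \<beta>" "\<beta> < 1"
    and "DP_inducible P C \<beta> A \<A>"
    and "\<pi> \<in> policies A"
  shows "\<exists>\<pi>' \<in> induced_policies A \<A> \<pi>.
           \<pi>' \<in> uniformly_feasible P C \<beta> A \<pi> \<and>
           (\<forall>x. induced_optimal_value P R \<gamma> A \<A> x \<pi> = discounted_value P R \<gamma> \<pi>' x)"
proof -
  let ?F = "induced_policies A \<A> \<pi>"
  have mem: "\<pi> x \<in> \<A> \<pi> x" for x
    using assms(6,7) by (auto simp: DP_inducible_def)
  have feasible: "?F \<subseteq> uniformly_feasible P C \<beta> A \<pi>"
    using assms(6,7) by (auto simp: DP_inducible_def)
  have "\<pi> \<in> ?F"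
    using mem assms(7) by (simp add: induced_policies_def)
  then have "?F \<noteq> {}" by blast
  \<comment> \<open>Membership is decided state by state, so mixing two members by any predicate
    stays inside.\<close>
  moreover have "(\<lambda>y. if B y then h y else g y) \<in> ?F" if "g \<in> ?F" "h \<in> ?F" for g h B
    using that by (auto simp: induced_policies_def policies_def)
  \<comment> \<open>Finiteness of the set of policies comes from the finite types of states and
    actions.\<close>
  ultimately have "\<exists>g\<in>?F. \<forall>h\<in>?F. \<forall>x. discounted_value P R \<gamma> h x \<le> discounted_value P R \<gamma> g x"
    by (intro ex_uniformly_optimal_policy[OF assms(2,3)] finite)
  then obtain g where g: "g \<in> ?F"
    and opt: "\<And>h x. h \<in> ?F \<Longrightarrow> discounted_value P R \<gamma> h x \<le> discounted_value P R \<gamma> g x"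
    by blast
  \<comment> \<open>The same \<open>g\<close> attains the maximum for every \<open>x\<close>, since
    \<open>opt\<close> holds in all states at once.\<close>
  have "induced_optimal_value P R \<gamma> A \<A> x \<pi> = discounted_value P R \<gamma> g x" for x
    unfolding induced_optimal_value_def using g opt by (intro Max_eqI) auto
  with g feasible show ?thesis by blast
qed

end
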